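(* Let $n\ge1$, $\delta>0$ and $\beta=n$. Let $b\in H^{\sigma}(\mathbf{T}^n)$ with $\sigma>n$. Let $$u(x,t)=\hat b_0\frac{t^2}{2}+\sum_{0\ne k\in\mathbb{Z}^n}\frac{\hat b_k}{m_k}\left[\cos(\sqrt{-m_k}\,t)-1\right]e^{ik\cdot x}.$$ Then $u(x,\cdot)\in C^\infty[0,\infty)$ (in the sense of classical derivatives in $t$) for any $x\in\mathbf{T}^n$.
   Context: For $k\in\mathbb{Z}^n$, $m_k=m^{\delta,\beta}(k)$, where for $\nu\in\mathbb{R}^n$ $$m^{\delta,\beta}(\nu)=-\|\nu\|^2\,{}_2F_3\!\left(1,\tfrac{n+2-\beta}{2};2,\tfrac{n+2}{2},\tfrac{n+4-\beta}{2};-\tfrac14\|\nu\|^2\delta^2\right),$$ ${}_2F_3(a_1,a_2;b_1,b_2,b_3;z)=\sum_{j\ge0}\frac{(a_1)_j(a_2)_j}{(b_1)_j(b_2)_j(b_3)_j}\frac{z^j}{j!}$, $(a)_j=a(a+1)\cdots(a+j-1)$; one has $m_k<0$ for all $k\neq0$. $\mathbf{T}^n=\prod_{j=1}^n[0,2\pi]$ is the periodic torus; a periodic distribution $g$ is written $g=\sum_{k\in\mathbb{Z}^n}\hat g_ke^{ik\cdot x}$ with Fourier coefficients $\hat g_k$; for $q\in\mathbb{R}$, $H^q(\mathbf{T}^n)$ is the space of periodic distributions with $\sum_{k\in\mathbb{Z}^n}(1+\|k\|^2)^q|\hat g_k|^2<\infty$. *)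

theory Defs
  imports "HOL-Analysis.Analysis"
begin

definition hyp2F3 :: "real \<Rightarrow> real \<Rightarrow> real \<Rightarrow> real \<Rightarrow> real \<Rightarrow> real \<Rightarrow> real" where
  "hyp2F3 a1 a2 b1 b2 b3 z =
     (\<Sum>j. pochhammer a1 j * pochhammer a2 j /
            (pochhammer b1 j * pochhammer b2 j * pochhammer b3 j) * (z ^ j / fact j))"

definition multiplier :: "real \<Rightarrow> real \<Rightarrow> real ^ 'n \<Rightarrow> real" where
  "multiplier \<delta> \<beta> \<nu> =
     - (norm \<nu>)\<^sup>2 *
       hyp2F3 1 ((real CARD('n) + 2 - \<beta>) / 2)
              2 ((real CARD('n) + 2) / 2) ((real CARD('n) + 4 - \<beta>) / 2)
              (- (1 / 4) * (norm \<nu>)\<^sup>2 * \<delta>\<^sup>2)"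

definition real_vec :: "int ^ 'n \<Rightarrow> real ^ 'n" where
  "real_vec k = (\<chi> i. real_of_int (k $ i))"

definition torus :: "(real ^ 'n) set" where
  "torus = {x. \<forall>i. x $ i \<in> {0..2 * pi}}"

definition character :: "int ^ 'n \<Rightarrow> real ^ 'n \<Rightarrow> complex" where
  "character k x = exp (\<i> * complex_of_real (real_vec k \<bullet> x))"

text \<open>Periodic distributions are the sequentially continuous linear functionals on the
  space of smooth complex functions that are \<open>2\<pi>\<close>-periodic in every coordinate, with
  uniform convergence of all derivatives. A functional is represented by a total function
  whose values outside the test space are irrelevant.\<close>

definition partial :: "'n \<Rightarrow> (real ^ 'n \<Rightarrow> complex) \<Rightarrow> real ^ 'n \<Rightarrow> complex" where
  "partial i f x = vector_derivative (\<lambda>s. f (x + s *\<^sub>R axis i 1)) (at 0)"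

definition partials :: "'n list \<Rightarrow> (real ^ 'n \<Rightarrow> complex) \<Rightarrow> real ^ 'n \<Rightarrow> complex" where
  "partials is f = foldr partial is f"

definition test_functions :: "(real ^ 'n \<Rightarrow> complex) set" where
  "test_functions =
     {f. (\<forall>is. partials is f differentiable_on UNIV) \<and>
         (\<forall>i x. f (x + (2 * pi) *\<^sub>R axis i 1) = f x)}"

definition periodic_distribution :: "((real ^ 'n \<Rightarrow> complex) \<Rightarrow> complex) \<Rightarrow> bool" where
  "periodic_distribution g \<longleftrightarrow>
     (\<forall>\<phi>\<in>test_functions. \<forall>\<psi>\<in>test_functions. g (\<lambda>x. \<phi> x + \<psi> x) = g \<phi> + g \<psi>) \<and>
     (\<forall>c. \<forall>\<phi>\<in>test_functions. g (\<lambda>x. c * \<phi> x) = c * g \<phi>) \<and>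
     (\<forall>\<Phi> \<phi>. (\<forall>j::nat. \<Phi> j \<in> test_functions) \<longrightarrow> \<phi> \<in> test_functions \<longrightarrow>
        (\<forall>is. uniform_limit UNIV (\<lambda>j. partials is (\<Phi> j)) (partials is \<phi>) sequentially) \<longrightarrow>
        (\<lambda>j. g (\<Phi> j)) \<longlonglongrightarrow> g \<phi>)"

text \<open>The normalisation is the one for which a function \<open>f\<close>, acting by integration of
  \<open>f \<phi>\<close> over the torus, has the Fourier series \<open>\<Sum>k. fourier_coeff f k * character k x\<close>.\<close>

definition fourier_coeff :: "((real ^ 'n \<Rightarrow> complex) \<Rightarrow> complex) \<Rightarrow> int ^ 'n \<Rightarrow> complex" where
  "fourier_coeff g k = g (character (- k)) / complex_of_real ((2 * pi) ^ CARD('n))"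

definition sobolev :: "real \<Rightarrow> ((real ^ 'n \<Rightarrow> complex) \<Rightarrow> complex) set" where
  "sobolev q =
     {g. periodic_distribution g \<and>
         (\<lambda>k. (1 + (norm (real_vec k))\<^sup>2) powr q * (cmod (fourier_coeff g k))\<^sup>2) summable_on UNIV}"

definition u_term ::
  "real \<Rightarrow> real \<Rightarrow> ((real ^ 'n \<Rightarrow> complex) \<Rightarrow> complex) \<Rightarrow> real ^ 'n \<Rightarrow> real \<Rightarrow> int ^ 'n \<Rightarrow> complex" where
  "u_term \<delta> \<beta> b x t k =
     (let m = multiplier \<delta> \<beta> (real_vec k) in
        fourier_coeff b k / complex_of_real m * complex_of_real (cos (sqrt (- m) * t) - 1)
        * character k x)"

definition u_sol ::
  "real \<Rightarrow> real \<Rightarrow> ((real ^ 'n \<Rightarrow> complex) \<Rightarrow> complex) \<Rightarrow> real ^ 'n \<Rightarrow> real \<Rightarrow> complex" where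
  "u_sol \<delta> \<beta> b x t =
     fourier_coeff b 0 * complex_of_real (t\<^sup>2 / 2) + (\<Sum>\<^sub>\<infinity>k\<in>{k. k \<noteq> 0}. u_term \<delta> \<beta> b x t k)"

text \<open>Derivatives at boundary points of \<open>S\<close> are taken within \<open>S\<close>, that is, one-sided at
  the endpoint of a half-line.\<close>

definition C_infinity_on :: "real set \<Rightarrow> (real \<Rightarrow> complex) \<Rightarrow> bool" where
  "C_infinity_on S f \<longleftrightarrow>
     (\<exists>D :: nat \<Rightarrow> real \<Rightarrow> complex.
        (\<forall>t\<in>S. D 0 t = f t) \<and>
        (\<forall>j. \<forall>t\<in>S. (D j has_vector_derivative D (Suc j) t) (at t within S)))"

lemma partial_character:
  fixes k :: "int ^ 'n"
  shows "partial i (\<lambda>x. c * character k x) = (\<lambda>x. (c * \<i> * of_int (k $ i)) * character k x)"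
proof
  fix x :: "real ^ 'n"
  have *: "real_vec k \<bullet> (x + s *\<^sub>R axis i 1) = real_vec k \<bullet> x + s * real_of_int (k $ i)" for s
    by (simp add: inner_add_right inner_axis real_vec_def)
  have "((\<lambda>s. c * character k (x + s *\<^sub>R axis i 1)) has_vector_derivative
          (c * \<i> * of_int (k $ i)) * character k x) (at 0)"
    unfolding character_def * of_real_add of_real_mult
    by (rule has_vector_derivative_eq_rhs,
        rule has_vector_derivative_real_field,
        (rule derivative_eq_intros refl)+, simp)
  then show "partial i (\<lambda>x. c * character k x) x = (c * \<i> * of_int (k $ i)) * character k x"
    unfolding partial_def by (rule vector_derivative_at)
qed

lemma character_test_function: "character k \<in> test_functions"
proof -
  have P: "\<exists>c. partials is (character k) = (\<lambda>x. c * character k x)" for "is"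
  proof (induction "is")
    case Nil
    show ?case by (rule exI[of _ 1]) (simp add: partials_def)
  next
    case (Cons i "is")
    then show ?case by (auto simp: partials_def partial_character)
  qed
  have E: "(exp :: complex \<Rightarrow> complex) differentiable (at z)" for z
    using DERIV_exp field_differentiable_def field_differentiable_imp_differentiable by blast
  have L: "(\<lambda>x. \<i> * complex_of_real (real_vec k \<bullet> x)) differentiable (at x)" for x
    by (intro bounded_linear_imp_differentiable bounded_linear_const_mult
              bounded_linear_compose[OF bounded_linear_of_real] bounded_linear_inner_right)
  have D: "(\<lambda>x. c * character k x) differentiable_on UNIV" for c
    unfolding differentiable_on_def character_def
    using differentiable_compose[OF E L] by (auto intro!: differentiable_mult)
  have "character k (x + (2 * pi) *\<^sub>R axis i 1) = character k x" for i x
  proof -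
    have *: "\<i> * complex_of_real (real_vec k \<bullet> (x + (2 * pi) *\<^sub>R axis i 1))
        = \<i> * complex_of_real (real_vec k \<bullet> x) + complex_of_real (real_of_int (2 * (k $ i)) * pi) * \<i>"
      by (simp add: inner_add_right inner_axis real_vec_def algebra_simps)
    show ?thesis
      unfolding character_def exp_eq using * by blast
  qed
  moreover have "partials is (character k) differentiable_on UNIV" for "is"
    using P[of "is"] D by (elim exE) simp
  ultimately show ?thesis
    unfolding test_functions_def by simp
qed

end

theory Submission imports Defs begin

text \<open>For \<open>\<beta> = n\<close> put \<open>b = n / 2\<close> and \<open>y = \<delta>\<^sup>2 \<parallel>k\<parallel>\<^sup>2 / 4\<close>. Then \<open>m\<^sub>k = - (4 / \<delta>\<^sup>2) P y\<close>, where
  \<open>y P' y = b (1 - H y)\<close> and \<open>H y\<close> is the Bessel--Clifford function \<open>\<^sub>0F\<^sub>1(; b; -y)\<close>. An energy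
  estimate gives \<open>\<bar>H\<bar> \<le> 1\<close> on the half-line, so \<open>m\<^sub>k\<close> grows at most logarithmically in \<open>\<parallel>k\<parallel>\<close>.
  Each derivative in \<open>t\<close> costs only a factor \<open>\<surd>\<bar>m\<^sub>k\<bar>\<close>, hence less than any power of \<open>\<parallel>k\<parallel>\<close>, and
  for \<open>\<sigma> > n\<close> all differentiated series converge absolutely. No lower bound on \<open>\<bar>m\<^sub>k\<bar>\<close> enters,
  since \<open>\<bar>cos (s t) - 1\<bar> \<le> s\<^sup>2 t\<^sup>2 / 2\<close> absorbs the denominator.\<close>

section \<open>Growth of the multipliers\<close>

definition clifford_coeff :: "real \<Rightarrow> nat \<Rightarrow> real" where
  "clifford_coeff b j = (-1) ^ j / (fact j * pochhammer b j)"

text \<open>For y > 0 this is Gamma(b) y^((1-b)/2) J_(b-1)(2 sqrt y), with J the Bessel function; b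
  = 1/2 gives cos(2 sqrt y).\<close>

definition clifford :: "real \<Rightarrow> real \<Rightarrow> real" where
  "clifford b y = (\<Sum>j. clifford_coeff b j * y ^ j)"

lemma clifford_coeff_0 [simp]: "clifford_coeff b 0 = 1"
  by (simp add: clifford_coeff_def)

text \<open>This is the equation y H'' + b H' + H = 0 read off at the power y^j.\<close>

lemma clifford_coeff_Suc:
  assumes "b > 0"
  shows "(real j + 1) * (b + real j) * clifford_coeff b (Suc j) = - clifford_coeff b j"
proof -
  have "pochhammer b j > 0" "b + real j > 0"
    using assms by (auto intro: pochhammer_pos)
  then show ?thesis
    by (simp add: clifford_coeff_def pochhammer_Suc divide_simps)
qed

text \<open>Each factor of \<open>pochhammer b j\<close> is at least 1/2, so the exponential series
  at 2|y| is a majorant.\<close>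

lemma summable_clifford:
  assumes "b \<ge> 1 / 2"
  shows "summable (\<lambda>j. clifford_coeff b j * y ^ j)"
proof (rule summable_comparison_test)
  have low: "(1 / 2) ^ j \<le> pochhammer b j" for j
  proof (induction j)
    case (Suc j)
    have "(1 / 2) ^ j * (1 / 2) \<le> pochhammer b j * (b + real j)"
      using Suc assms by (intro mult_mono) (auto intro!: pochhammer_nonneg)
    then show ?case by (simp add: pochhammer_Suc)
  qed simp
  show "\<exists>N. \<forall>j\<ge>N. norm (clifford_coeff b j * y ^ j) \<le> inverse (fact j) * (2 * \<bar>y\<bar>) ^ j"
  proof (intro exI allI impI)
    fix j :: nat
    have p: "pochhammer b j > 0"
      using assms by (auto intro: pochhammer_pos)
    have "1 / pochhammer b j \<le> 1 / (1 / 2) ^ j"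
      using low[of j] p by (intro divide_left_mono) auto
    then have "\<bar>y\<bar> ^ j / fact j * (1 / pochhammer b j) \<le> \<bar>y\<bar> ^ j / fact j * 2 ^ j"
      by (intro mult_left_mono) (auto simp: power_divide)
    then show "norm (clifford_coeff b j * y ^ j) \<le> inverse (fact j) * (2 * \<bar>y\<bar>) ^ j"
      using p by (simp add: clifford_coeff_def abs_mult power_abs power_mult_distrib field_simps)
  qed
  show "summable (\<lambda>j. inverse (fact j) * (2 * \<bar>y\<bar>) ^ j)"
    by (rule summable_exp)
qed

lemma summable_diffs_everywhere:
  fixes c :: "nat \<Rightarrow> real"
  assumes "\<And>y. summable (\<lambda>j. c j * y ^ j)"
  shows "summable (\<lambda>j. diffs c j * y ^ j)"
  by (rule termdiff_converges[of y "\<bar>y\<bar> + 1"]) (use assms in auto)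

lemma clifford_0 [simp]: "clifford b 0 = 1"
  by (simp add: clifford_def)

lemma clifford_ode:
  assumes b: "b \<ge> 1 / 2"
  obtains H1 H2 where
    "\<And>y. (clifford b has_real_derivative H1 y) (at y)"
    "\<And>y. (H1 has_real_derivative H2 y) (at y)"
    "\<And>y. y * H2 y + b * H1 y + clifford b y = 0"
proof
  define c where "c = clifford_coeff b"
  let ?H1 = "\<lambda>y. \<Sum>j. diffs c j * y ^ j"
  let ?H2 = "\<lambda>y. \<Sum>j. diffs (diffs c) j * y ^ j"
  have s: "summable (\<lambda>j. c j * y ^ j)" for y
    unfolding c_def by (rule summable_clifford[OF b])
  have s1: "summable (\<lambda>j. diffs c j * y ^ j)" for y
    by (rule summable_diffs_everywhere[OF s])
  have s2: "summable (\<lambda>j. diffs (diffs c) j * y ^ j)" for y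
    by (rule summable_diffs_everywhere[OF s1])
  show "(clifford b has_real_derivative ?H1 y) (at y)" for y
    using termdiffs_strong_converges_everywhere[OF s, of y]
    unfolding clifford_def[abs_def] c_def .
  show "(?H1 has_real_derivative ?H2 y) (at y)" for y
    by (rule termdiffs_strong_converges_everywhere[OF s1])
  fix y :: real
  \<comment> \<open>Multiplication by y shifts the index by one; the term added at j = 0 vanishes
    because of the factor \<open>real j\<close>.\<close>
  have "(\<lambda>j. real j * diffs c j * y ^ j) sums (y * ?H2 y)"
  proof -
    have "(\<lambda>j. y * (diffs (diffs c) j * y ^ j)) sums (y * ?H2 y)"
      by (intro sums_mult summable_sums s2)
    then have "(\<lambda>j. real (Suc j) * diffs c (Suc j) * y ^ Suc j) sums (y * ?H2 y)"
      by (simp add: diffs_def[of "diffs c"] mult_ac)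
    then show ?thesis
      by (subst (asm) sums_Suc_iff) simp
  qed
  moreover have "(\<lambda>j. b * (diffs c j * y ^ j)) sums (b * ?H1 y)"
    by (intro sums_mult summable_sums s1)
  moreover have "(\<lambda>j. c j * y ^ j) sums clifford b y"
    unfolding clifford_def using summable_sums[OF s] by (simp add: c_def)
  ultimately have "(\<lambda>j. real j * diffs c j * y ^ j + b * (diffs c j * y ^ j) + c j * y ^ j)
      sums (y * ?H2 y + b * ?H1 y + clifford b y)"
    by (intro sums_add)
  moreover have "real j * diffs c j * y ^ j + b * (diffs c j * y ^ j) + c j * y ^ j = 0" for j
  proof -
    have "(real j + 1) * (b + real j) * c (Suc j) + c j = 0"
      using clifford_coeff_Suc[of b j] b by (simp add: c_def)
    moreover have "real j * diffs c j * y ^ j + b * (diffs c j * y ^ j) + c j * y ^ j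
        = ((real j + 1) * (b + real j) * c (Suc j) + c j) * y ^ j"
      by (simp add: diffs_def algebra_simps)
    ultimately show ?thesis by simp
  qed
  ultimately show "y * ?H2 y + b * ?H1 y + clifford b y = 0"
    using sums_unique2[OF _ sums_zero] by simp
qed

text \<open>The energy \<open>H\<^sup>2 + y H'\<^sup>2\<close> of the equation \<open>y H'' + b H' + H = 0\<close> has derivative
  \<open>(1 - 2 b) H'\<^sup>2\<close>.\<close>

lemma abs_clifford_le_1:
  assumes b: "b \<ge> 1 / 2" and y: "y \<ge> 0"
  shows "\<bar>clifford b y\<bar> \<le> 1"
proof -
  obtain H1 H2 where
    d: "\<And>y. (clifford b has_real_derivative H1 y) (at y)"
       "\<And>y. (H1 has_real_derivative H2 y) (at y)" and
    ode: "\<And>y. y * H2 y + b * H1 y + clifford b y = 0"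
    using clifford_ode[OF b] by blast
  define E where "E y = (clifford b y)\<^sup>2 + y * (H1 y)\<^sup>2" for y
  have "E y \<le> E 0"
  proof (rule DERIV_nonpos_imp_nonincreasing[OF y])
    fix x :: real
    have "(E has_real_derivative
        2 * clifford b x * H1 x + ((H1 x)\<^sup>2 + x * (2 * H1 x * H2 x))) (at x)"
      unfolding E_def
      by (rule derivative_eq_intros d refl | simp)+
    \<comment> \<open>The last bracket is the left-hand side of the differential equation. What
      remains is nonpositive since b \<ge> 1/2.\<close>
    moreover have "2 * clifford b x * H1 x + ((H1 x)\<^sup>2 + x * (2 * H1 x * H2 x))
        = (1 - 2 * b) * (H1 x)\<^sup>2 + 2 * H1 x * (x * H2 x + b * H1 x + clifford b x)"
      by (simp add: algebra_simps power2_eq_square)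
    moreover have "(1 - 2 * b) * (H1 x)\<^sup>2 \<le> 0"
      using b by (intro mult_nonpos_nonneg) auto
    ultimately show "\<exists>d. (E has_real_derivative d) (at x) \<and> d \<le> 0"
      using ode[of x] by auto
  qed
  \<comment> \<open>\<open>E 0\<close> is 1, and discarding this term from \<open>E y\<close> leaves
    the square of \<open>clifford b y\<close>.\<close>
  moreover have "y * (H1 y)\<^sup>2 \<ge> 0" using y by simp
  ultimately have "(clifford b y)\<^sup>2 \<le> 1" by (simp add: E_def)
  then show ?thesis by (simp add: abs_square_le_1)
qed

text \<open>From |H| \<le> 1 follows |P'| \<le> 2b/y, which integrates to a logarithm away from 0.
  Near 0 this bound is not integrable, and continuity of P on [0,1] is used instead.\<close>

lemma clifford_primitive_le_ln:
  assumes b: "b \<ge> 1 / 2"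
    and d: "\<And>y. (P has_real_derivative P' y) (at y)"
    and P': "\<And>y. y * P' y = b * (1 - clifford b y)"
  obtains A where "A \<ge> 0" "\<And>y. y \<ge> 0 \<Longrightarrow> \<bar>P y\<bar> \<le> A + 2 * b * ln (1 + y)"
proof -
  have "continuous_on {0..1} P"
    using d by (meson DERIV_continuous_on has_field_derivative_at_within)
  then have "compact (P ` {0..1})"
    by (intro compact_continuous_image) auto
  then obtain A where A: "\<And>y. 0 \<le> y \<Longrightarrow> y \<le> 1 \<Longrightarrow> \<bar>P y\<bar> \<le> A"
    by (fastforce dest!: compact_imp_bounded simp: bounded_iff)
  have P'_bound: "\<bar>P' y\<bar> \<le> 2 * b / y" if "y > 0" for y
  proof -
    have "\<bar>y * P' y\<bar> \<le> b * 2"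
      unfolding P' abs_mult using abs_clifford_le_1[OF b, of y] that b
      by (intro mult_mono) auto
    then show ?thesis using that by (simp add: abs_mult field_simps)
  qed
  \<comment> \<open>Both P - 2b ln and -P - 2b ln are nonincreasing on the half-line from 1.\<close>
  have large: "\<bar>P y\<bar> \<le> A + 2 * b * ln y" if y: "y \<ge> 1" for y
  proof -
    have "P y - 2 * b * ln y \<le> P 1 - 2 * b * ln 1"
    proof (rule DERIV_nonpos_imp_nonincreasing[OF y])
      fix x :: real assume "1 \<le> x"
      then have "((\<lambda>y. P y - 2 * b * ln y) has_real_derivative P' x - 2 * b / x) (at x)"
        by (auto intro!: derivative_eq_intros d)
      then show "\<exists>z. ((\<lambda>y. P y - 2 * b * ln y) has_real_derivative z) (at x) \<and> z \<le> 0"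
        using P'_bound[of x] \<open>1 \<le> x\<close> by (intro exI[of _ "P' x - 2 * b / x"]) auto
    qed
    moreover have "- P y - 2 * b * ln y \<le> - P 1 - 2 * b * ln 1"
    proof (rule DERIV_nonpos_imp_nonincreasing[OF y])
      fix x :: real assume "1 \<le> x"
      then have "((\<lambda>y. - P y - 2 * b * ln y) has_real_derivative - P' x - 2 * b / x) (at x)"
        by (auto intro!: derivative_eq_intros d)
      then show "\<exists>z. ((\<lambda>y. - P y - 2 * b * ln y) has_real_derivative z) (at x) \<and> z \<le> 0"
        using P'_bound[of x] \<open>1 \<le> x\<close> by (intro exI[of _ "- P' x - 2 * b / x"]) auto
    qed
    ultimately show ?thesis using A[of 1] by auto
  qed
  have "\<bar>P y\<bar> \<le> A + 2 * b * ln (1 + y)" if y: "y \<ge> 0" for y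
  proof (cases "y \<le> 1")
    case True
    have "0 \<le> 2 * b * ln (1 + y)" using y b by simp
    with A[OF y True] show ?thesis by linarith
  next
    case False
    then have "2 * b * ln y \<le> 2 * b * ln (1 + y)"
      using b by (intro mult_left_mono) auto
    with large[of y] False show ?thesis by linarith
  qed
  moreover have "A \<ge> 0" using A[of 0] by auto
  ultimately show ?thesis using that by blast
qed

text \<open>With b = n/2 these are the parameters of the multiplier for \<beta> = n. The product P y
  is a power series without constant term; y P' = b (1 - H) means that its coefficients satisfy j
  p_j = -b c_j for j \<ge> 1, where c_j are those of H.\<close>

lemma hyp2F3_le_ln:
  assumes b: "b \<ge> 1 / 2"
  obtains A where "A \<ge> 0"
    "\<And>y. y \<ge> 0 \<Longrightarrow> \<bar>y * hyp2F3 1 1 2 (b + 1) 2 (- y)\<bar> \<le> A + 2 * b * ln (1 + y)"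
proof -
  \<comment> \<open>\<open>p 0 = 0\<close> because \<open>x / 0 = 0\<close>.\<close>
  define p where "p j = - b * clifford_coeff b j / real j" for j
  have sc: "summable (\<lambda>j. clifford_coeff b j * y ^ j)" for y
    by (rule summable_clifford[OF b])
  have sp: "summable (\<lambda>j. p j * y ^ j)" for y
  proof (rule summable_comparison_test')
    \<comment> \<open>Convergence at |y| + 1 gives absolute convergence at y, which has smaller
      modulus.\<close>
    show "summable (\<lambda>j. b * \<bar>clifford_coeff b j * y ^ j\<bar>)"
      by (intro summable_mult) (rule powser_insidea[OF sc[of "\<bar>y\<bar> + 1"], of y, simplified])
    have "\<bar>x\<bar> / real j \<le> \<bar>x\<bar>" for x j
      by (cases j) (auto simp: field_simps mult_right_mono)
    from this[of "b * (clifford_coeff b j * y ^ j)" j for j] b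
    show "norm (p j * y ^ j) \<le> b * \<bar>clifford_coeff b j * y ^ j\<bar>" if "j \<ge> 0" for j
      by (simp add: p_def abs_mult mult.assoc)
  qed
  \<comment> \<open>With (1)_j = j!, (2)_j = (j+1)! and b (b+1)_j = (b)_(j+1), the hypergeometric
    term of index j times y is the term of index j+1 of P.\<close>
  have coeff: "pochhammer 1 j * pochhammer 1 j /
      (pochhammer 2 j * pochhammer (b + 1) j * pochhammer 2 j) * ((- y) ^ j / fact j) * y
      = p (Suc j) * y ^ Suc j" for j and y :: real
  proof -
    have "pochhammer (2::real) j = fact (Suc j)"
      using pochhammer_rec[of "1::real" j] by (simp add: pochhammer_fact[symmetric])
    moreover have "pochhammer b (Suc j) = b * pochhammer (b + 1) j"
      by (rule pochhammer_rec)
    moreover have "pochhammer (b + 1) j > 0"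
      using b by (auto intro: pochhammer_pos)
    moreover have "(- y) ^ j = (-1) ^ j * y ^ j"
      by (rule power_minus)
    ultimately show ?thesis
      using b by (simp add: p_def clifford_coeff_def pochhammer_fact[symmetric] divide_simps)
  qed
  have P: "y * hyp2F3 1 1 2 (b + 1) 2 (- y) = (\<Sum>j. p j * y ^ j)" for y
  proof (cases "y = 0")
    case True
    then show ?thesis using powser_zero[of p] by (simp add: p_def[of 0])
  next
    case False
    have "(\<lambda>j. p (Suc j) * y ^ Suc j) sums (\<Sum>j. p j * y ^ j)"
      using summable_sums[OF sp[of y]] by (subst sums_Suc_iff) (simp add: p_def)
    then have "(\<lambda>j. p (Suc j) * y ^ Suc j / y) sums ((\<Sum>j. p j * y ^ j) / y)"
      by (rule sums_divide)
    then have "hyp2F3 1 1 2 (b + 1) 2 (- y) = (\<Sum>j. p j * y ^ j) / y"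
      unfolding hyp2F3_def coeff[symmetric] using False by (simp add: sums_iff)
    then show ?thesis using False by simp
  qed
  have "((\<lambda>y. \<Sum>j. p j * y ^ j) has_real_derivative (\<Sum>j. diffs p j * y ^ j)) (at y)" for y
    by (rule termdiffs_strong_converges_everywhere[OF sp])
  \<comment> \<open>Termwise differentiation cancels the divisor j in \<open>p\<close>; the index
    shift removes the constant term 1 of H.\<close>
  moreover have "y * (\<Sum>j. diffs p j * y ^ j) = b * (1 - clifford b y)" for y
  proof -
    have "(\<lambda>j. clifford_coeff b (Suc j) * y ^ Suc j) sums (clifford b y - 1)"
      using summable_sums[OF sc[of y]] by (subst sums_Suc_iff) (simp add: clifford_def)
    then have "(\<lambda>j. - b * (clifford_coeff b (Suc j) * y ^ Suc j)) sums (- b * (clifford b y - 1))"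
      by (rule sums_mult)
    moreover have "- b * (clifford_coeff b (Suc j) * y ^ Suc j) = y * (diffs p j * y ^ j)" for j
      by (simp add: diffs_def p_def)
    moreover have "(\<lambda>j. y * (diffs p j * y ^ j)) sums (y * (\<Sum>j. diffs p j * y ^ j))"
      by (intro sums_mult summable_sums summable_diffs_everywhere sp)
    ultimately show ?thesis
      using sums_unique2 by (fastforce simp: algebra_simps)
  qed
  ultimately show ?thesis
    using clifford_primitive_le_ln[OF b, of "\<lambda>y. \<Sum>j. p j * y ^ j" "\<lambda>y. \<Sum>j. diffs p j * y ^ j"] that
    unfolding P by blast
qed

lemma multiplier_le_ln:
  fixes \<delta> :: real
  assumes \<delta>: "\<delta> > 0"
  obtains A B c where "A \<ge> 0" "B \<ge> 0" "c \<ge> 1"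
    "\<And>\<nu> :: real ^ 'n. \<bar>multiplier \<delta> (real CARD('n)) \<nu>\<bar> \<le> A + B * ln (c * (1 + (norm \<nu>)\<^sup>2))"
proof -
  define b where "b = real CARD('n) / 2"
  have b: "b \<ge> 1 / 2" by (simp add: b_def Suc_leI)
  obtain A where A: "A \<ge> 0"
    "\<And>y. y \<ge> 0 \<Longrightarrow> \<bar>y * hyp2F3 1 1 2 (b + 1) 2 (- y)\<bar> \<le> A + 2 * b * ln (1 + y)"
    using hyp2F3_le_ln[OF b] by metis
  \<comment> \<open>Chosen so that 1 + y \<le> c (1 + |\<nu>|^2) for the rescaled variable y
    below.\<close>
  define c where "c = 1 + \<delta>\<^sup>2 / 4"
  have c: "c \<ge> 1" by (simp add: c_def)
  have "\<bar>multiplier \<delta> (real CARD('n)) \<nu>\<bar>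
      \<le> 4 / \<delta>\<^sup>2 * A + 4 / \<delta>\<^sup>2 * (2 * b) * ln (c * (1 + (norm \<nu>)\<^sup>2))" for \<nu> :: "real ^ 'n"
  proof -
    define y where "y = 1 / 4 * (norm \<nu>)\<^sup>2 * \<delta>\<^sup>2"
    have y: "y \<ge> 0" by (simp add: y_def)
    have "multiplier \<delta> (real CARD('n)) \<nu> = - (norm \<nu>)\<^sup>2 * hyp2F3 1 1 2 (b + 1) 2 (- y)"
      by (simp add: multiplier_def b_def y_def add_divide_distrib)
    also have "\<dots> = - (4 / \<delta>\<^sup>2 * (y * hyp2F3 1 1 2 (b + 1) 2 (- y)))"
      using \<delta> by (simp add: y_def)
    finally have "\<bar>multiplier \<delta> (real CARD('n)) \<nu>\<bar>
        = 4 / \<delta>\<^sup>2 * \<bar>y * hyp2F3 1 1 2 (b + 1) 2 (- y)\<bar>"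
      by (simp add: abs_mult)
    also have "\<dots> \<le> 4 / \<delta>\<^sup>2 * (A + 2 * b * ln (1 + y))"
      by (intro mult_left_mono A y) auto
    also have "\<dots> \<le> 4 / \<delta>\<^sup>2 * (A + 2 * b * ln (c * (1 + (norm \<nu>)\<^sup>2)))"
    proof -
      have "1 + y \<le> c * (1 + (norm \<nu>)\<^sup>2)"
      proof -
        have "c * (1 + (norm \<nu>)\<^sup>2) = 1 + y + (\<delta>\<^sup>2 / 4 + (norm \<nu>)\<^sup>2)"
          by (simp add: y_def c_def field_simps)
        then show ?thesis by simp
      qed
      then have "ln (1 + y) \<le> ln (c * (1 + (norm \<nu>)\<^sup>2))"
        using y by (intro ln_mono) auto
      then show ?thesis using b by (intro mult_left_mono add_left_mono) auto
    qed
    finally show ?thesis by (simp add: algebra_simps)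
  qed
  moreover have "4 / \<delta>\<^sup>2 * A \<ge> 0" "4 / \<delta>\<^sup>2 * (2 * b) \<ge> 0" using A(1) b by auto
  ultimately show ?thesis using that c by blast
qed

text \<open>A logarithm grows more slowly than any positive power, and so does each fixed power of
  it.\<close>

lemma multiplier_power_le_powr:
  fixes \<delta> \<epsilon> :: real
  assumes "\<delta> > 0" "\<epsilon> > 0"
  obtains C where "C \<ge> 0"
    "\<And>\<nu> :: real ^ 'n.
       (1 + \<bar>multiplier \<delta> (real CARD('n)) \<nu>\<bar>) ^ p \<le> C * (1 + (norm \<nu>)\<^sup>2) powr \<epsilon>"
proof -
  obtain A B c where ABc: "A \<ge> 0" "B \<ge> 0" "c \<ge> 1" and
    le: "\<And>\<nu> :: real ^ 'n. \<bar>multiplier \<delta> (real CARD('n)) \<nu>\<bar> \<le> A + B * ln (c * (1 + (norm \<nu>)\<^sup>2))"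
    using multiplier_le_ln[OF assms(1)] by metis
  \<comment> \<open>The p-th power multiplies the exponent by p, so \<eta> p \<le> \<epsilon> is
    required; p + 1 keeps the divisor nonzero when p = 0.\<close>
  define \<eta> where "\<eta> = \<epsilon> / (real p + 1)"
  have \<eta>: "\<eta> > 0" "\<eta> * real p \<le> \<epsilon>"
    using assms(2) by (auto simp: \<eta>_def field_simps)
  \<comment> \<open>The summand B/\<eta> comes from ln w \<le> w^\<eta> / \<eta>, the summand 1 + A
    from 1 \<le> w^\<eta>.\<close>
  define K where "K = 1 + A + B / \<eta>"
  have K: "K \<ge> 0" using ABc \<eta> by (simp add: K_def)
  have "(1 + \<bar>multiplier \<delta> (real CARD('n)) \<nu>\<bar>) ^ p
      \<le> K ^ p * c powr \<epsilon> * (1 + (norm \<nu>)\<^sup>2) powr \<epsilon>" for \<nu> :: "real ^ 'n"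
  proof -
    define w where "w = c * (1 + (norm \<nu>)\<^sup>2)"
    have w: "w \<ge> 1"
      using mult_mono[of 1 c 1 "1 + (norm \<nu>)\<^sup>2"] ABc by (simp add: w_def)
    have w1: "w powr \<eta> \<ge> 1" using w \<eta> by (simp add: ge_one_powr_ge_zero)
    have "1 + \<bar>multiplier \<delta> (real CARD('n)) \<nu>\<bar> \<le> (1 + A) * 1 + B * ln w"
      using le[of \<nu>] by (simp add: w_def)
    also have "\<dots> \<le> (1 + A) * w powr \<eta> + B * (w powr \<eta> / \<eta>)"
      using ABc w1 ln_powr_bound[OF w \<eta>(1)] by (intro add_mono mult_left_mono) auto
    also have "\<dots> = K * w powr \<eta>" by (simp add: K_def algebra_simps)
    finally have "(1 + \<bar>multiplier \<delta> (real CARD('n)) \<nu>\<bar>) ^ p \<le> (K * w powr \<eta>) ^ p"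
      by (intro power_mono) auto
    also have "\<dots> = K ^ p * w powr (\<eta> * real p)"
      using w by (simp add: power_mult_distrib powr_powr[symmetric] powr_realpow)
    also have "\<dots> \<le> K ^ p * w powr \<epsilon>"
      using K w \<eta> by (intro mult_left_mono powr_mono) auto
    also have "\<dots> = K ^ p * c powr \<epsilon> * (1 + (norm \<nu>)\<^sup>2) powr \<epsilon>"
      using ABc by (simp add: w_def powr_mult)
    finally show ?thesis .
  qed
  moreover have "K ^ p * c powr \<epsilon> \<ge> 0" using K by simp
  ultimately show ?thesis using that by blast
qed

section \<open>Lattice sums\<close>

lemma summable_on_inverse_one_plus_square:
  "(\<lambda>i :: int. 1 / (1 + (real_of_int i)\<^sup>2)) summable_on UNIV"
proof -
  have "summable (\<lambda>n. 1 / (1 + (real n)\<^sup>2))"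
  proof (rule summable_comparison_test_ev)
    show "\<forall>\<^sub>F n in sequentially. norm (1 / (1 + (real n)\<^sup>2)) \<le> inverse (real n ^ 2)"
      using eventually_gt_at_top[of 0]
      by eventually_elim (auto simp: divide_simps add_pos_nonneg)
    show "summable (\<lambda>n. inverse (real n ^ 2))"
      by (rule inverse_power_summable) auto
  qed
  then have s: "(\<lambda>n. 1 / (1 + (real n)\<^sup>2)) summable_on UNIV"
    by (intro norm_summable_imp_summable_on) simp
  \<comment> \<open>Two copies of the naturals cover the integers; their overlap at 0 is harmless
    for summability.\<close>
  have "(\<lambda>i. 1 / (1 + (real_of_int i)\<^sup>2)) summable_on range int"
    using s by (subst summable_on_reindex) (auto simp: o_def)
  moreover have "(\<lambda>i. 1 / (1 + (real_of_int i)\<^sup>2)) summable_on range (\<lambda>n. - int n)"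
    using s by (subst summable_on_reindex) (auto simp: o_def inj_on_def)
  ultimately have "(\<lambda>i. 1 / (1 + (real_of_int i)\<^sup>2)) summable_on (range int \<union> range (\<lambda>n. - int n))"
    by (rule summable_on_union)
  moreover have "range int \<union> range (\<lambda>n. - int n) = UNIV"
    by (metis (no_types, lifting) UNIV_eq_I UnI1 UnI2 int_cases2 rangeI)
  ultimately show ?thesis by simp
qed

text \<open>Since 1 + k_i^2 \<le> 1 + |k|^2 for each coordinate, the summand is at most a product of
  one-dimensional summands. Any finite set of lattice points lies in a box, over which the sum of
  products factors.\<close>

lemma summable_on_lattice:
  "(\<lambda>k :: int ^ 'n. 1 / (1 + (norm (real_vec k))\<^sup>2) ^ CARD('n)) summable_on UNIV"
proof (rule nonneg_bdd_above_summable_on)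
  let ?f = "\<lambda>i :: int. 1 / (1 + (real_of_int i)\<^sup>2)"
  let ?g = "\<lambda>k :: int ^ 'n. 1 / (1 + (norm (real_vec k))\<^sup>2) ^ CARD('n)"
  have le: "?g k \<le> (\<Prod>i\<in>UNIV. ?f (k $ i))" for k
  proof -
    have "(\<Prod>i\<in>UNIV. 1 + (real_of_int (k $ i))\<^sup>2) \<le> (\<Prod>i\<in>(UNIV :: 'n set). 1 + (norm (real_vec k))\<^sup>2)"
    proof (rule prod_mono, safe)
      fix i
      have "\<bar>real_vec k $ i\<bar> \<le> norm (real_vec k)" by (rule component_le_norm_cart)
      then have "\<bar>real_vec k $ i\<bar>\<^sup>2 \<le> (norm (real_vec k))\<^sup>2" by (intro power_mono) auto
      then show "1 + (real_of_int (k $ i))\<^sup>2 \<le> 1 + (norm (real_vec k))\<^sup>2"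
        by (simp add: real_vec_def)
    qed auto
    moreover have "(\<Prod>i\<in>(UNIV :: 'n set). 1 + (real_of_int (k $ i))\<^sup>2) > 0"
      by (intro prod_pos) (auto simp: add_pos_nonneg)
    ultimately show ?thesis
      by (simp add: prod_dividef frac_le)
  qed
  have "sum ?g F \<le> (infsum ?f UNIV) ^ CARD('n)" if F: "finite F" for F
  proof -
    \<comment> \<open>\<open>B\<close> collects all coordinates occurring in \<open>F\<close>, so
      the coordinate functions of points of \<open>F\<close> map into \<open>B\<close>.\<close>
    define B where "B = (\<Union>k\<in>F. range (\<lambda>i. k $ i))"
    have B: "finite B" using F by (simp add: B_def)
    have inj: "inj_on vec_nth F" by (simp add: inj_on_def vec_nth_inject)
    have "sum ?g F \<le> (\<Sum>k\<in>F. \<Prod>i\<in>UNIV. ?f (k $ i))"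
      by (intro sum_mono le)
    also have "\<dots> = (\<Sum>h\<in>vec_nth ` F. \<Prod>i\<in>UNIV. ?f (h i))"
      using inj by (simp add: sum.reindex)
    also have "\<dots> \<le> (\<Sum>h\<in>(UNIV :: 'n set) \<rightarrow>\<^sub>E B. \<Prod>i\<in>UNIV. ?f (h i))"
      using B by (intro sum_mono2 finite_PiE) (auto simp: B_def intro!: prod_nonneg)
    also have "\<dots> = (\<Prod>i\<in>(UNIV :: 'n set). sum ?f B)"
      using B by (subst prod_sum_PiE) auto
    also have "\<dots> \<le> (infsum ?f UNIV) ^ CARD('n)"
      using B by (auto intro!: power_mono sum_nonneg finite_sum_le_infsum
          summable_on_inverse_one_plus_square)
    finally show ?thesis .
  qed
  then show "bdd_above (sum ?g ` {F. F \<subseteq> UNIV \<and> finite F})"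
    by (intro bdd_aboveI2) auto
qed simp

text \<open>Half of the excess \<sigma> - n pays for the growth of the multiplier; XY \<le> X^2 +
  Y^2 then separates the Sobolev sum from the lattice sum.\<close>

lemma summable_on_fourier_coeff_multiplier:
  fixes b :: "(real ^ 'n \<Rightarrow> complex) \<Rightarrow> complex"
  assumes "\<delta> > 0" "\<sigma> > real CARD('n)" "b \<in> sobolev \<sigma>"
  shows "(\<lambda>k. cmod (fourier_coeff b k) *
           (1 + \<bar>multiplier \<delta> (real CARD('n)) (real_vec k)\<bar>) ^ p) summable_on UNIV"
proof -
  \<comment> \<open>This value splits w^\<epsilon> into w^(\<sigma>/2) w^(-n/2), whose squares are
    the Sobolev weight and the lattice summand.\<close>
  define \<epsilon> where "\<epsilon> = (\<sigma> - real CARD('n)) / 2"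
  have \<epsilon>: "\<epsilon> > 0" using assms by (simp add: \<epsilon>_def)
  obtain C where C: "C \<ge> 0"
    "\<And>\<nu> :: real ^ 'n.
       (1 + \<bar>multiplier \<delta> (real CARD('n)) \<nu>\<bar>) ^ p \<le> C * (1 + (norm \<nu>)\<^sup>2) powr \<epsilon>"
    using multiplier_power_le_powr[OF assms(1) \<epsilon>] by metis
  let ?a = "\<lambda>k. (1 + (norm (real_vec k))\<^sup>2) powr \<sigma> * (cmod (fourier_coeff b k))\<^sup>2"
  let ?d = "\<lambda>k :: int ^ 'n. 1 / (1 + (norm (real_vec k))\<^sup>2) ^ CARD('n)"
  have "(\<lambda>k. C * (?a k + ?d k)) summable_on UNIV"
    using assms(3) by (intro summable_on_cmult_right summable_on_add summable_on_lattice)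
      (simp add: sobolev_def)
  then show ?thesis
  proof (rule summable_on_comparison_test)
    fix k :: "int ^ 'n"
    define w where "w = 1 + (norm (real_vec k))\<^sup>2"
    have w: "w > 0" by (simp add: w_def add_pos_nonneg)
    define X where "X = w powr (\<sigma> / 2) * cmod (fourier_coeff b k)"
    define Y where "Y = w powr (- real CARD('n) / 2)"
    have "w powr \<epsilon> * cmod (fourier_coeff b k) = X * Y"
      by (simp add: X_def Y_def \<epsilon>_def powr_add[symmetric] diff_divide_distrib)
    also have "\<dots> \<le> X\<^sup>2 + Y\<^sup>2"
    proof -
      have "X * Y \<ge> 0" by (simp add: X_def Y_def)
      then show ?thesis using sum_squares_bound[of X Y] by simp
    qed
    also have "X\<^sup>2 = ?a k"
      using w by (simp add: X_def power_mult_distrib w_def[symmetric] power2_eq_square[of "_ powr _"]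
          powr_add[symmetric])
    also have "Y\<^sup>2 = ?d k"
      using w by (simp add: Y_def w_def[symmetric] power2_eq_square[of "_ powr _"]
          powr_add[symmetric] powr_minus powr_realpow field_simps)
    finally have *: "w powr \<epsilon> * cmod (fourier_coeff b k) \<le> ?a k + ?d k" .
    have "cmod (fourier_coeff b k) * (1 + \<bar>multiplier \<delta> (real CARD('n)) (real_vec k)\<bar>) ^ p
        \<le> cmod (fourier_coeff b k) * (C * w powr \<epsilon>)"
      unfolding w_def by (intro mult_left_mono C) auto
    also have "\<dots> \<le> C * (?a k + ?d k)"
      using mult_left_mono[OF * C(1)] by (simp add: mult_ac)
    finally show "cmod (fourier_coeff b k) * (1 + \<bar>multiplier \<delta> (real CARD('n)) (real_vec k)\<bar>) ^ p
        \<le> C * (?a k + ?d k)" .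
  qed simp
qed

section \<open>Termwise differentiation\<close>

text \<open>The mean value inequality, applied first to f' and then to the linearisation of f, gives
  the constant M in place of the sharp M/2.\<close>

lemma second_order_bound:
  fixes f f' f'' :: "real \<Rightarrow> 'a :: real_normed_vector"
  assumes d: "\<And>t. (f has_vector_derivative f' t) (at t)"
    and d': "\<And>t. (f' has_vector_derivative f'' t) (at t)"
    and M: "\<And>t. norm (f'' t) \<le> M"
  shows "norm (f y - f x - (y - x) *\<^sub>R f' x) \<le> M * (y - x)\<^sup>2"
proof -
  have f': "norm (f' z - f' x) \<le> M * \<bar>y - x\<bar>" if z: "z \<in> closed_segment x y" for z
  proof -
    have "norm (f' z - f' x) \<le> M * norm (z - x)"
      by (rule differentiable_bound[where S = UNIV and f' = "\<lambda>t h. h *\<^sub>R f'' t"])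
        (use d' M in \<open>auto simp: has_vector_derivative_def mult.commute[of M] mult_left_mono
          intro!: onorm_le\<close>)
    also have "\<dots> \<le> M * \<bar>y - x\<bar>"
      using z order_trans[OF norm_ge_zero M[of x]]
      by (intro mult_left_mono) (auto simp: closed_segment_eq_real_ivl split: if_splits)
    finally show ?thesis .
  qed
  have "norm (f y - f x - (y - x) *\<^sub>R f' x) \<le> norm (y - x) * (M * \<bar>y - x\<bar>)"
    by (rule vector_differentiable_bound_linearization[where S = "closed_segment x y"])
      (auto intro: f' has_vector_derivative_at_within d)
  then show ?thesis by (simp add: power2_eq_square algebra_simps)
qed

text \<open>The quadratic remainders of the terms add up to at most (y - x)^2 times the sum of the
  \<open>M k\<close>, hence to o(|y - x|).\<close>

lemma has_vector_derivative_infsum: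
  fixes f f' f'' :: "'b \<Rightarrow> real \<Rightarrow> 'a :: banach"
  assumes d: "\<And>k t. k \<in> A \<Longrightarrow> (f k has_vector_derivative f' k t) (at t)"
    and d': "\<And>k t. k \<in> A \<Longrightarrow> (f' k has_vector_derivative f'' k t) (at t)"
    and M: "\<And>k t. k \<in> A \<Longrightarrow> norm (f'' k t) \<le> M k"
    and sM: "M summable_on A"
    and s: "\<And>t. (\<lambda>k. f k t) summable_on A"
    and s': "\<And>t. (\<lambda>k. f' k t) summable_on A"
  shows "((\<lambda>t. \<Sum>\<^sub>\<infinity>k\<in>A. f k t) has_vector_derivative (\<Sum>\<^sub>\<infinity>k\<in>A. f' k x)) (at x)"
proof -
  let ?F = "\<lambda>t. \<Sum>\<^sub>\<infinity>k\<in>A. f k t"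
  let ?D = "\<Sum>\<^sub>\<infinity>k\<in>A. f' k x"
  have bound: "norm (?F y - ?F x - (y - x) *\<^sub>R ?D) \<le> infsum M A * (y - x)\<^sup>2" for y
  proof (rule norm_infsum_le)
    show "((\<lambda>k. f k y - f k x - (y - x) *\<^sub>R f' k x) has_sum (?F y - ?F x - (y - x) *\<^sub>R ?D)) A"
      unfolding diff_conv_add_uminus scaleR_minus_left[symmetric]
      by (intro has_sum_add has_sum_scaleR has_sum_infsum s s' has_sum_uminus[THEN iffD2])
        (simp add: has_sum_infsum s)
    show "((\<lambda>k. M k * (y - x)\<^sup>2) has_sum (infsum M A * (y - x)\<^sup>2)) A"
      by (intro has_sum_cmult_left has_sum_infsum sM)
    show "norm (f k y - f k x - (y - x) *\<^sub>R f' k x) \<le> M k * (y - x)\<^sup>2" if "k \<in> A" for k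
      using that by (intro second_order_bound[where f'' = "f'' k"] d d' M)
  qed
  \<comment> \<open>At y = x the quotient is 0, as \<open>inverse 0 = 0\<close>, so the majorant
    holds for every y.\<close>
  have "((\<lambda>y. norm ((?F y - ?F x - (y - x) *\<^sub>R ?D) /\<^sub>R norm (y - x))) \<longlongrightarrow> 0) (at x)"
  proof (rule tendsto_sandwich[OF always_eventually always_eventually tendsto_const])
    show "((\<lambda>y. infsum M A * \<bar>y - x\<bar>) \<longlongrightarrow> 0) (at x)"
      by (auto intro!: tendsto_eq_intros)
    show "\<forall>y. norm ((?F y - ?F x - (y - x) *\<^sub>R ?D) /\<^sub>R norm (y - x)) \<le> infsum M A * \<bar>y - x\<bar>"
    proof
      fix y
      show "norm ((?F y - ?F x - (y - x) *\<^sub>R ?D) /\<^sub>R norm (y - x)) \<le> infsum M A * \<bar>y - x\<bar>"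
        using bound[of y] by (cases "y = x") (auto simp: divide_simps power2_eq_square mult_ac
            abs_mult_self_eq[of "y - x", symmetric] simp del: abs_mult_self_eq)
    qed
  qed simp
  then show ?thesis
    unfolding has_vector_derivative_def has_derivative_at_within tendsto_norm_zero_iff
    by (auto intro: bounded_linear_scaleR_left)
qed

section \<open>Time factors of the Fourier modes\<close>

text \<open>All derivatives vanish for \<open>m = 0\<close>, since \<open>x / 0 = 0\<close>; this matches the value of the summand there.\<close>

fun mode :: "real \<Rightarrow> nat \<Rightarrow> real \<Rightarrow> real" where
  "mode m 0 t = (cos (sqrt (- m) * t) - 1) / m"
| "mode m (Suc j) t = sqrt (- m) ^ Suc j / m * cos (sqrt (- m) * t + real (Suc j) * (pi / 2))"

text \<open>Each differentiation brings out a factor \<open>sqrt (- m)\<close> and advances the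
  phase by \<pi>/2; order 0 is separate because of its constant -1.\<close>

lemma mode_has_derivative: "(mode m j has_real_derivative mode m (Suc j) t) (at t)"
proof (cases j)
  case 0
  have "((\<lambda>t. (cos (sqrt (- m) * t) - 1) / m) has_real_derivative
      - (sin (sqrt (- m) * t) * sqrt (- m)) / m) (at t)"
    by (cases "m = 0") (auto intro!: derivative_eq_intros)
  then show ?thesis unfolding 0 mode.simps[abs_def] by (simp add: cos_add mult.commute[of "sin _"])
next
  case (Suc i)
  have "cos (x + real (Suc (Suc i)) * (pi / 2)) = - sin (x + real (Suc i) * (pi / 2))" for x
  proof -
    have "x + real (Suc (Suc i)) * (pi / 2) = (x + real (Suc i) * (pi / 2)) + pi / 2"
      by (simp add: field_simps)
    then show ?thesis by (simp only: cos_add[of _ "pi / 2"] cos_pi_half sin_pi_half)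
  qed
  then show ?thesis unfolding Suc mode.simps[abs_def]
    by (cases "m = 0") (auto intro!: derivative_eq_intros)
qed

text \<open>The real \<open>sqrt\<close> is an odd function, so the identity holds for either sign
  of m, and with it the bounds on \<open>mode\<close>.\<close>

lemma sqrt_uminus_power2: "(sqrt (- m))\<^sup>2 = \<bar>m\<bar>"
proof (cases "m \<ge> 0")
  case True
  then show ?thesis by (simp add: real_sqrt_minus)
next
  case False
  then show ?thesis by (subst real_sqrt_pow2) auto
qed

text \<open>Two of the factors \<open>sqrt (- m)\<close> cancel the denominator. The bound is
  uniform in t.\<close>

lemma abs_mode_add_2: "\<bar>mode m (j + 2) t\<bar> \<le> (1 + \<bar>m\<bar>) ^ j"
proof (cases "m = 0")
  case False
  have "\<bar>sqrt (- m)\<bar>\<^sup>2 \<le> (1 + \<bar>m\<bar>)\<^sup>2"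
    using zero_le_power2[of "\<bar>m\<bar>"] by (simp add: sqrt_uminus_power2 power2_sum)
  then have s: "\<bar>sqrt (- m)\<bar> \<le> 1 + \<bar>m\<bar>" by (rule power2_le_imp_le) simp
  have "\<bar>mode m (j + 2) t\<bar> \<le> \<bar>sqrt (- m) ^ (j + 2) / m\<bar> * 1"
    unfolding add_2_eq_Suc' mode.simps abs_mult by (intro mult_left_mono abs_cos_le_one) simp
  also have "\<dots> = \<bar>sqrt (- m)\<bar> ^ j * \<bar>m\<bar> / \<bar>m\<bar>"
    unfolding abs_divide abs_mult power_add sqrt_uminus_power2 power_abs by simp
  also have "\<dots> = \<bar>sqrt (- m)\<bar> ^ j"
    using False by simp
  also have "\<dots> \<le> (1 + \<bar>m\<bar>) ^ j" using s by (intro power_mono) auto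
  finally show ?thesis .
qed simp

text \<open>With s = \<open>sqrt (- m)\<close>, 1 - cos(s t) = 2 sin(s t/2)^2 \<le> s^2 t^2 / 2, and
  s^2 contributes the |m| that cancels the denominator.\<close>

lemma abs_mode_0: "\<bar>mode m 0 t\<bar> \<le> t\<^sup>2"
proof (cases "m = 0")
  case False
  have "cos (sqrt (- m) * t) = 1 - 2 * (sin (sqrt (- m) * t / 2))\<^sup>2"
    using cos_double_sin[of "sqrt (- m) * t / 2"] by simp
  moreover have "(sin (sqrt (- m) * t / 2))\<^sup>2 \<le> (sqrt (- m) * t / 2)\<^sup>2"
    by (metis abs_ge_zero abs_sin_x_le_abs_x power2_abs power_mono)
  ultimately have "\<bar>cos (sqrt (- m) * t) - 1\<bar> \<le> 2 * (sqrt (- m) * t / 2)\<^sup>2"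
    by simp
  also have "\<dots> = \<bar>m\<bar> * t\<^sup>2 / 2"
    by (simp add: power_mult_distrib power_divide sqrt_uminus_power2)
  also have "\<dots> \<le> \<bar>m\<bar> * t\<^sup>2" by simp
  finally show ?thesis using False by (simp add: field_simps)
qed simp

text \<open>The inequality |sin z| \<le> |z| supplies a second factor \<open>sqrt (- m)\<close>
  against the denominator.\<close>

lemma abs_mode_1: "\<bar>mode m 1 t\<bar> \<le> \<bar>t\<bar>"
proof (cases "m = 0")
  case False
  have "\<bar>sqrt (- m) * sin (sqrt (- m) * t)\<bar> \<le> \<bar>sqrt (- m)\<bar> * \<bar>sqrt (- m) * t\<bar>"
    unfolding abs_mult[of _ "sin _"] by (intro mult_left_mono abs_sin_x_le_abs_x) simp
  also have "\<dots> = (sqrt (- m))\<^sup>2 * \<bar>t\<bar>"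
    by (simp add: abs_mult power2_eq_square)
  also have "\<dots> = \<bar>m\<bar> * \<bar>t\<bar>" unfolding sqrt_uminus_power2 ..
  finally have "\<bar>sqrt (- m) * sin (sqrt (- m) * t)\<bar> / \<bar>m\<bar> \<le> \<bar>t\<bar>"
    using False by (simp add: pos_divide_le_eq mult.commute)
  then show ?thesis by (simp add: cos_add abs_mult)
qed simp

text \<open>For fixed t, orders 0 and 1 are bounded independently of k and use weight power 0; order
  i + 2 uses weight power i.\<close>

lemma summable_on_mode:
  fixes a :: "'b \<Rightarrow> complex"
  assumes s: "\<And>p. (\<lambda>k. cmod (a k) * (1 + \<bar>m k\<bar>) ^ p) summable_on A"
  shows "(\<lambda>k. a k * of_real (mode (m k) j t)) summable_on A"
proof -
  have "\<exists>C p. \<forall>k. \<bar>mode (m k) j t\<bar> \<le> C * (1 + \<bar>m k\<bar>) ^ p"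
  proof -
    consider "j = 0" | "j = 1" | i where "j = i + 2"
      by (metis One_nat_def add_2_eq_Suc' not0_implies_Suc)
    then show ?thesis
    proof cases
      case 1
      then show ?thesis using abs_mode_0 by (intro exI[of _ "t\<^sup>2"] exI[of _ 0]) auto
    next
      case 2
      then show ?thesis using abs_mode_1 by (intro exI[of _ "\<bar>t\<bar>"] exI[of _ 0]) auto
    next
      case 3
      then show ?thesis using abs_mode_add_2 by (intro exI[of _ 1] exI[of _ i]) auto
    qed
  qed
  then obtain C p where C: "\<And>k. \<bar>mode (m k) j t\<bar> \<le> C * (1 + \<bar>m k\<bar>) ^ p" by blast
  have "(\<lambda>k. C * (cmod (a k) * (1 + \<bar>m k\<bar>) ^ p)) summable_on A"
    by (intro summable_on_cmult_right s)
  then have "(\<lambda>k. norm (a k * of_real (mode (m k) j t))) summable_on A"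
  proof (rule Infinite_Sum.abs_summable_on_comparison_test')
    fix k
    show "norm (a k * of_real (mode (m k) j t)) \<le> C * (cmod (a k) * (1 + \<bar>m k\<bar>) ^ p)"
      using mult_left_mono[OF C, of "cmod (a k)" k] by (simp add: norm_mult mult_ac)
  qed
  then show ?thesis by (rule abs_summable_summable)
qed

text \<open>The second derivative of \<open>mode m j\<close> is the mode of order j + 2, for which
  the bound uniform in t is available for every j.\<close>

lemma infsum_mode_has_derivative:
  fixes a :: "'b \<Rightarrow> complex"
  assumes s: "\<And>p. (\<lambda>k. cmod (a k) * (1 + \<bar>m k\<bar>) ^ p) summable_on A"
  shows "((\<lambda>t. \<Sum>\<^sub>\<infinity>k\<in>A. a k * of_real (mode (m k) j t)) has_vector_derivative
           (\<Sum>\<^sub>\<infinity>k\<in>A. a k * of_real (mode (m k) (Suc j) t))) (at t)"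
proof (rule has_vector_derivative_infsum[where M = "\<lambda>k. cmod (a k) * (1 + \<bar>m k\<bar>) ^ j"
      and f'' = "\<lambda>k t. a k * of_real (mode (m k) (Suc (Suc j)) t)"])
  have d: "((\<lambda>t. a k * of_real (mode (m k) j t)) has_vector_derivative
      a k * of_real (mode (m k) (Suc j) t)) (at t)" for k j t
    by (intro has_vector_derivative_mult_right has_vector_derivative_of_real)
      (simp only: has_real_derivative_iff_has_vector_derivative[symmetric] mode_has_derivative)
  show "((\<lambda>t. a k * of_real (mode (m k) j t)) has_vector_derivative
      a k * of_real (mode (m k) (Suc j) t)) (at t)" for k t
    by (rule d)
  show "((\<lambda>t. a k * of_real (mode (m k) (Suc j) t)) has_vector_derivative
      a k * of_real (mode (m k) (Suc (Suc j)) t)) (at t)" for k t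
    by (rule d)
  show "norm (a k * of_real (mode (m k) (Suc (Suc j)) t)) \<le> cmod (a k) * (1 + \<bar>m k\<bar>) ^ j" for k t
    unfolding norm_mult norm_of_real using abs_mode_add_2[of "m k" j t]
    by (intro mult_left_mono) (simp_all del: mode.simps)
qed (intro summable_on_mode s)+

theorem theorem22:
  fixes \<delta> \<beta> \<sigma> :: real
    and b :: "(real ^ 'n \<Rightarrow> complex) \<Rightarrow> complex"
  assumes "\<delta> > 0"
    and "\<beta> = real CARD('n)"
    and "\<sigma> > real CARD('n)"
    and "b \<in> sobolev \<sigma>"
  shows "\<forall>x\<in>torus.
           (\<forall>t\<ge>0. u_term \<delta> \<beta> b x t summable_on {k. k \<noteq> 0}) \<and>
           C_infinity_on {0..} (u_sol \<delta> \<beta> b x)"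
proof
  fix x :: "real ^ 'n"
  \<comment> \<open>The character has modulus 1, so the estimates for the Fourier coefficients carry
    over at every point x.\<close>
  define a where "a k = fourier_coeff b k * character k x" for k
  define m where "m k = multiplier \<delta> \<beta> (real_vec k :: real ^ 'n)" for k
  have "cmod (a k) = cmod (fourier_coeff b k)" for k
    by (simp add: a_def character_def norm_mult)
  then have s: "(\<lambda>k. cmod (a k) * (1 + \<bar>m k\<bar>) ^ p) summable_on {k. k \<noteq> 0}" for p
    using summable_on_fourier_coeff_multiplier[OF assms(1,3,4), of p]
    unfolding m_def assms(2) by (auto intro: summable_on_subset_banach)
  have u: "u_term \<delta> \<beta> b x t = (\<lambda>k. a k * of_real (mode (m k) 0 t))" for t
    by (simp add: fun_eq_iff u_term_def Let_def a_def m_def)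
  \<comment> \<open>The successive derivatives of t^2/2, the time factor of the zero mode.\<close>
  define z :: "nat \<Rightarrow> real \<Rightarrow> real"
    where "z j t = (if j = 0 then t\<^sup>2 / 2 else if j = 1 then t else if j = 2 then 1 else 0)" for j t
  have z: "(z j has_real_derivative z (Suc j) t) (at t)" for j t
    unfolding z_def[abs_def] by (auto intro!: derivative_eq_intros)
  \<comment> \<open>These functions are differentiable on the whole line; restricting to the
    half-line gives the one-sided derivative at 0.\<close>
  define D where "D j t = fourier_coeff b 0 * of_real (z j t) +
      (\<Sum>\<^sub>\<infinity>k\<in>{k. k \<noteq> 0}. a k * of_real (mode (m k) j t))" for j t
  have "(D j has_vector_derivative D (Suc j) t) (at t)" for j t
    unfolding D_def
    by (intro has_vector_derivative_add has_vector_derivative_mult_right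
        has_vector_derivative_of_real infsum_mode_has_derivative s)
      (simp only: has_real_derivative_iff_has_vector_derivative[symmetric] z)
  moreover have "D 0 t = u_sol \<delta> \<beta> b x t" for t
    by (simp add: D_def u_sol_def u z_def)
  ultimately have "C_infinity_on {0..} (u_sol \<delta> \<beta> b x)"
    unfolding C_infinity_on_def by (blast intro: has_vector_derivative_at_within)
  \<comment> \<open>Summability ensures that the infinite sum in \<open>u_sol\<close> is genuine and
    not the default value 0.\<close>
  then show "(\<forall>t\<ge>0. u_term \<delta> \<beta> b x t summable_on {k. k \<noteq> 0}) \<and>
      C_infinity_on {0..} (u_sol \<delta> \<beta> b x)"
    unfolding u using summable_on_mode[OF s] by blast
qed

end
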